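(* Let $1 < p \leq q < \infty$, let $p' := p/(p-1)$, let $0 \leq \theta < \pi/2$, let $\alpha < p-1$, and let $\mu$ be a positive Borel measure on $\mathbb{C}_+$ supported only in the sector $$S(\theta) := \{z \in \mathbb{C}_+ : |\arg(z)| < \theta\}.$$ For an interval $I = (0, |I|) \subset \mathbb{R}$ define $$\Delta_I := \{z \in S(\theta) : \operatorname{Re}(z) \leq |I|\}.$$ Then the Laplace--Carleson embedding $\mathfrak{L} : L^p_{t^\alpha}(0,\infty) \to L^q(\mathbb{C}_+, \mu)$ is well-defined and bounded if and only if there exists a constant $C(\mu) > 0$ such that $$\mu(\Delta_I) \leq C(\mu)\, |I|^{\frac{q}{p'}\left(1 - \frac{\alpha}{p-1}\right)}$$ for all intervals $I = (0, |I|) \subset \mathbb{R}$.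
   Context: $\mathbb{C}_+ := \{z \in \mathbb{C} : \operatorname{Re}(z) > 0\}$. For a measurable $w : (0,\infty) \to (0,\infty)$ and $1 \leq p < \infty$, $L^p_w(0,\infty)$ is the Banach space of (classes of) measurable functions $f : (0,\infty) \to \mathbb{C}$ with $\|f\|_{L^p_w(0,\infty)} := \left(\int_0^\infty |f(t)|^p w(t)\,dt\right)^{1/p} < \infty$; $L^p_{t^\alpha}(0,\infty)$ is the case $w(t) = t^\alpha$. The Laplace transform is $\mathfrak{L}f(z) := \int_0^\infty f(t) e^{-tz}\,dt$. The Laplace--Carleson embedding $\mathfrak{L}: L^p_w(0,\infty)\to L^q(\mathbb{C}_+,\mu)$ is the map $f \mapsto \mathfrak{L}f$; it is bounded if there is a constant $C>0$ with $\left(\int_{\mathbb{C}_+} |\mathfrak{L}f|^q\,d\mu\right)^{p/q} \leq C \int_0^\infty |f(t)|^p w(t)\,dt$ for all $f \in L^p_w(0,\infty)$. *)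

theory Defs
  imports "HOL-Analysis.Analysis"
begin

definition right_half_plane :: "complex set" where
  "right_half_plane = {z. Re z > 0}"

definition sector :: "real \<Rightarrow> complex set" where
  "sector \<theta> = {z \<in> right_half_plane. \<bar>Arg z\<bar> < \<theta>}"

(* The parameter l is the length of the interval I = (0, l). *)
definition carleson_set :: "real \<Rightarrow> real \<Rightarrow> complex set" where
  "carleson_set \<theta> l = {z \<in> sector \<theta>. Re z \<le> l}"

(* Function spaces are sets of functions rather than of classes modulo null sets. *)
definition Lp_functions :: "real \<Rightarrow> 'a measure \<Rightarrow> ('a \<Rightarrow> complex) set" where
  "Lp_functions p M =
    {f \<in> borel_measurable M. integrable M (\<lambda>x. norm (f x) powr p)}"

definition weighted_Lp_functions :: "real \<Rightarrow> (real \<Rightarrow> real) \<Rightarrow> (real \<Rightarrow> complex) set" where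
  "weighted_Lp_functions p w =
    {f \<in> borel_measurable (lebesgue_on {0<..}).
       integrable (lebesgue_on {0<..}) (\<lambda>t. norm (f t) powr p * w t)}"

definition laplace_integrand :: "(real \<Rightarrow> complex) \<Rightarrow> complex \<Rightarrow> real \<Rightarrow> complex" where
  "laplace_integrand f z t = f t * exp (- (complex_of_real t * z))"

definition laplace_transform :: "(real \<Rightarrow> complex) \<Rightarrow> complex \<Rightarrow> complex" where
  "laplace_transform f z = (LINT t|lebesgue_on {0<..}. laplace_integrand f z t)"

(* The Bochner integral of a non-integrable function is 0, so convergence of the Laplace
   integral on the half-plane has to be required explicitly. *)
definition laplace_embedding_well_defined ::
    "real \<Rightarrow> (real \<Rightarrow> real) \<Rightarrow> real \<Rightarrow> complex measure \<Rightarrow> bool" where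
  "laplace_embedding_well_defined p w q \<mu> \<longleftrightarrow>
    (\<forall>f \<in> weighted_Lp_functions p w.
       (\<forall>z \<in> right_half_plane. integrable (lebesgue_on {0<..}) (laplace_integrand f z)) \<and>
       laplace_transform f \<in> Lp_functions q \<mu>)"

(* Meaningful together with well-definedness, which makes both integrals finite. *)
definition laplace_embedding_bounded ::
    "real \<Rightarrow> (real \<Rightarrow> real) \<Rightarrow> real \<Rightarrow> complex measure \<Rightarrow> bool" where
  "laplace_embedding_bounded p w q \<mu> \<longleftrightarrow>
    (\<exists>C>0. \<forall>f \<in> weighted_Lp_functions p w.
       (LINT z|\<mu>. norm (laplace_transform f z) powr q) powr (p / q)
         \<le> C * (LINT t|lebesgue_on {0<..}. norm (f t) powr p * w t))"

end

theory Submission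
  imports Defs
begin

text \<open>
  Necessity: if \<open>b\<close> is a small multiple of \<open>1 / l\<close>, then \<open>\<bar>t z\<bar>\<close> stays bounded for \<open>t\<close> in
  \<open>[b/2, b]\<close> and \<open>z\<close> in the Carleson set, so the real part of the transform of the indicator of
  \<open>[b/2, b]\<close> is there at least a constant times \<open>b\<close>; now apply Markov's inequality.

  Sufficiency: write \<open>x = Re z\<close>, let \<open>F x\<close> be the Laplace transform of \<open>\<bar>f\<bar>\<close> and \<open>N\<close> the \<open>p\<close>-th
  power of the weighted norm of \<open>f\<close>. Hoelder's inequality with the weight \<open>t powr \<kappa>\<close> gives,
  for every \<open>\<kappa> < p - 1\<close>, that \<open>F x powr p\<close> is at most a constant times \<open>x powr (\<kappa> - (p - 1))\<close>
  times the integral of \<open>\<bar>f t\<bar> powr p * t powr \<kappa> * exp (- t * x)\<close> over \<open>t\<close>. Split \<open>F powr q\<close> as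
  \<open>F powr p\<close> times a power of \<open>F powr p\<close>; use this bound with some \<open>\<kappa> > \<alpha>\<close> for the first factor,
  and with \<open>\<kappa> = \<alpha>\<close> (which gives a power of \<open>N\<close>) for the second. After Tonelli's theorem only
  the integrals of \<open>x powr (- \<delta>) * exp (- t * x)\<close> against \<open>\<mu>\<close> remain, and by the layer-cake
  formula the growth condition bounds these by a power of \<open>t\<close>.
\<close>

subsection \<open>Inequalities for integrals\<close>

text \<open>Young's inequality for \<open>u\<close> and \<open>v\<close> divided by their norms;
  integrating it makes the right-hand side exactly \<open>A * B\<close>.\<close>

lemma Holder_inequality:
  fixes u v :: "'a \<Rightarrow> real"
  assumes pq: "1 < p" "1 < r" "1 / p + 1 / r = 1"
    and [measurable]: "u \<in> borel_measurable M" "v \<in> borel_measurable M"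
    and nn: "\<And>x. 0 \<le> u x" "\<And>x. 0 \<le> v x"
    and iu: "integrable M (\<lambda>x. u x powr p)" and iv: "integrable M (\<lambda>x. v x powr r)"
  shows "integrable M (\<lambda>x. u x * v x)"
    and "(LINT x|M. u x * v x) \<le> (LINT x|M. u x powr p) powr (1 / p) * (LINT x|M. v x powr r) powr (1 / r)"
proof -
  define U where "U = (LINT x|M. u x powr p)"
  define V where "V = (LINT x|M. v x powr r)"
  \<comment> \<open>Without normalisation Young's inequality yields only integrability of the
    product, which the normalised argument then uses.\<close>
  have young: "u x * v x \<le> u x powr p / p + v x powr r / r" for x
    using Youngs_inequality[of p r "u x" "v x"] pq nn by simp
  show int: "integrable M (\<lambda>x. u x * v x)"
  proof (rule Bochner_Integration.integrable_bound)
    show "integrable M (\<lambda>x. u x powr p / p + v x powr r / r)"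
      using iu iv by simp
    show "AE x in M. norm (u x * v x) \<le> norm (u x powr p / p + v x powr r / r)"
      using young nn pq by (intro AE_I2) (smt (verit) real_norm_def mult_nonneg_nonneg)
  qed simp
  have U0: "U \<ge> 0" and V0: "V \<ge> 0"
    by (simp_all add: U_def V_def)
  show "(LINT x|M. u x * v x) \<le> U powr (1 / p) * V powr (1 / r)"
  \<comment> \<open>A vanishing norm cannot be divided by, but then one factor, and with it the
    product, is zero almost everywhere.\<close>
  proof (cases "U = 0 \<or> V = 0")
    case True
    have "AE x in M. u x * v x = 0"
      using True
    proof
      assume "U = 0"
      hence "AE x in M. u x powr p = 0"
        unfolding U_def by (subst (asm) integral_nonneg_eq_0_iff_AE) (use iu in auto)
      thus ?thesis by eventually_elim auto
    next
      assume "V = 0"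
      hence "AE x in M. v x powr r = 0"
        unfolding V_def by (subst (asm) integral_nonneg_eq_0_iff_AE) (use iv in auto)
      thus ?thesis by eventually_elim auto
    qed
    hence "(LINT x|M. u x * v x) = 0"
      by (rule integral_eq_zero_AE)
    thus ?thesis using True by auto
  next
    case False
    define A where "A = U powr (1 / p)"
    define B where "B = V powr (1 / r)"
    have pos: "A > 0" "B > 0" "U > 0" "V > 0" using False U0 V0 by (auto simp: A_def B_def)
    have A: "A powr p = U" and B: "B powr r = V"
      using pos pq by (auto simp: A_def B_def powr_powr)
    have "u x * v x \<le> A * B * (u x powr p / (U * p) + v x powr r / (V * r))" for x
    proof -
      have "(u x / A) * (v x / B) \<le> (u x / A) powr p / p + (v x / B) powr r / r"
        using Youngs_inequality[of p r "u x / A" "v x / B"] pq nn pos by simp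
      also have "\<dots> = u x powr p / (U * p) + v x powr r / (V * r)"
        using pos nn by (simp add: powr_divide A B)
      finally show ?thesis using pos by (simp add: field_simps)
    qed
    hence "(LINT x|M. u x * v x) \<le> (LINT x|M. A * B * (u x powr p / (U * p) + v x powr r / (V * r)))"
      using iu iv int by (intro integral_mono) auto
    also have "\<dots> = A * B * (U / (U * p) + V / (V * r))"
      using iu iv by (simp add: U_def V_def)
    also have "\<dots> = A * B" using pos pq by simp
    finally show ?thesis by (simp add: A_def B_def)
  qed
qed

section \<open>Gamma integrals on the half-line and sigma-finiteness\<close>

lemma measurable_ident_lebesgue_on [measurable]:
  "(\<lambda>t. t) \<in> borel_measurable (lebesgue_on A)"
  by (intro measurable_restrict_space1 measurable_completion) simp

lemma nn_integral_lebesgue_on_greaterThan: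
  "(\<integral>\<^sup>+t. f t \<partial>lebesgue_on {a<..}) = (\<integral>\<^sup>+t. f t * indicator {a<..} t \<partial>lborel)"
  for a :: real
  by (subst nn_integral_restrict_space) (auto simp: nn_integral_completion)

text \<open>Euler's integral for \<open>Gamma a\<close> after the substitution of
  \<open>x * t\<close> for \<open>t\<close>. The extended nonnegative form gives convergence and
  value at once.\<close>

lemma nn_integral_powr_exp:
  fixes a x :: real
  assumes "a > 0" "x > 0"
  shows "(\<integral>\<^sup>+t. ennreal (t powr (a - 1) * exp (- (t * x))) \<partial>lebesgue_on {0<..})
    = ennreal (Gamma a * x powr (- a))"
proof -
  have "ennreal (Gamma a) = (\<integral>\<^sup>+t. ennreal (indicator {0..} t * t powr (a - 1) / exp t) \<partial>lborel)"
    using Gamma_conv_nn_integral_real[OF assms(1)] .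
  also have "\<dots> = ennreal x * (\<integral>\<^sup>+t. ennreal (indicator {0..} (x * t) * (x * t) powr (a - 1) / exp (x * t)) \<partial>lborel)"
    by (subst nn_integral_real_affine[where c = x and t = 0]) (use assms in auto)
  also have "\<dots> = (\<integral>\<^sup>+t. ennreal (x powr a) * (ennreal (t powr (a - 1) * exp (- (t * x))) * indicator {0<..} t) \<partial>lborel)"
  \<comment> \<open>The indicators of \<open>{0..}\<close> and \<open>{0<..}\<close> disagree at the
    origin, which is discarded as a null set.\<close>
  proof (subst nn_integral_cmult[symmetric], simp, rule nn_integral_cong_AE, rule AE_mp[OF AE_lborel_singleton[of 0]], intro AE_I2 impI)
    fix t :: real assume "t \<noteq> 0"
    have "x * x powr (a - 1) = x powr a" using assms by (simp add: powr_diff)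
    thus "ennreal x * ennreal (indicator {0..} (x * t) * (x * t) powr (a - 1) / exp (x * t)) =
         ennreal (x powr a) * (ennreal (t powr (a - 1) * exp (- (t * x))) * indicator {0<..} t)"
      using assms \<open>t \<noteq> 0\<close>
      by (cases "t > 0") (auto simp: indicator_def zero_le_mult_iff powr_mult exp_minus field_simps
            ennreal_mult[symmetric] simp flip: ennreal_mult')
  qed
  also have "\<dots> = ennreal (x powr a) * (\<integral>\<^sup>+t. ennreal (t powr (a - 1) * exp (- (t * x))) \<partial>lebesgue_on {0<..})"
    by (subst nn_integral_cmult) (auto simp: nn_integral_lebesgue_on_greaterThan)
  finally have *: "ennreal (Gamma a) = \<dots>" .
  have "ennreal (Gamma a * x powr (- a)) = ennreal (x powr (- a)) * ennreal (Gamma a)"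
    using assms by (simp add: ennreal_mult mult.commute less_imp_le[OF Gamma_real_pos])
  also have "\<dots> = ennreal (x powr (- a) * x powr a) * (\<integral>\<^sup>+t. ennreal (t powr (a - 1) * exp (- (t * x))) \<partial>lebesgue_on {0<..})"
    by (subst *) (simp add: ennreal_mult mult.assoc)
  also have "x powr (- a) * x powr a = 1"
    using assms by (simp flip: powr_add)
  finally show ?thesis by simp
qed

lemma sigma_finite_lebesgue_on:
  assumes "A \<in> sets lebesgue"
  shows "sigma_finite_measure (lebesgue_on (A :: 'a :: euclidean_space set))"
proof -
  obtain F :: "nat \<Rightarrow> 'a set" where F: "range F \<subseteq> sets lborel" "(\<Union>i. F i) = space lborel"
     "\<And>i. emeasure lborel (F i) \<noteq> \<infinity>"
    using lborel.sigma_finite by (metis)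
  have "sigma_finite_measure (lebesgue :: 'a measure)"
  proof
    show "\<exists>B. countable B \<and> B \<subseteq> sets (lebesgue :: 'a measure) \<and> \<Union> B = space lebesgue \<and> (\<forall>a\<in>B. emeasure lebesgue a \<noteq> \<infinity>)"
      by (rule exI[of _ "range F"]) (use F in \<open>auto simp: image_subset_iff\<close>)
  qed
  thus ?thesis using assms by (intro sigma_finite_measure_restrict_space) auto
qed

text \<open>Tonelli's theorem needs a sigma-finite measure; the growth condition supplies this
  through an exhaustion by sublevel sets.\<close>

lemma sigma_finite_measure_sublevels:
  fixes X :: "'a \<Rightarrow> real"
  assumes [measurable]: "X \<in> borel_measurable M"
    and finite: "\<And>y. y > 0 \<Longrightarrow> emeasure M {z \<in> space M. X z \<le> y} < \<infinity>"
  shows "sigma_finite_measure M"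
proof -
  \<comment> \<open>\<open>Suc n\<close> keeps every level positive, as the finiteness hypothesis
    requires.\<close>
  define A where "A n = {z \<in> space M. X z \<le> real (Suc n)}" for n
  show ?thesis
  proof
    show "\<exists>B. countable B \<and> B \<subseteq> sets M \<and> \<Union> B = space M \<and> (\<forall>a\<in>B. emeasure M a \<noteq> \<infinity>)"
    proof (intro exI[of _ "range A"] conjI ballI)
      have "\<exists>n. X z \<le> real (Suc n)" for z
      proof -
        obtain n where "X z \<le> real n" using real_arch_simple by blast
        thus ?thesis by (intro exI[of _ n]) simp
      qed
      thus "\<Union> (range A) = space M" by (auto simp: A_def)
      fix a assume "a \<in> range A"
      then obtain n where "a = A n" by auto
      thus "emeasure M a \<noteq> \<infinity>"
        using finite[of "real (Suc n)"] by (auto simp: A_def)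
    qed (auto simp: A_def)
  qed
qed

text \<open>Layer-cake argument: the integrand is a decreasing function of \<open>X z\<close> that
  tends to 0, hence the integral of \<open>g\<close> over \<open>[X z, \<infinity>)\<close>.
  Tonelli's theorem turns the left side into an integral of \<open>g y\<close> times the measure of
  a sublevel set. The growth bound leaves two Gamma integrals, which converge at 0 because
  \<open>\<delta> < s\<close>.\<close>

lemma nn_integral_powr_exp_le:
  fixes M :: "'a measure" and X :: "'a \<Rightarrow> real"
  assumes X [measurable]: "X \<in> borel_measurable M" and pos: "\<And>z. z \<in> space M \<Longrightarrow> X z > 0"
    and \<delta>: "0 < \<delta>" "\<delta> < s" and C: "C \<ge> 0" and t: "t > 0"
    and growth: "\<And>y. y > 0 \<Longrightarrow> emeasure M {z \<in> space M. X z \<le> y} \<le> ennreal (C * y powr s)"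
  shows "(\<integral>\<^sup>+z. ennreal (X z powr (- \<delta>) * exp (- (t * X z))) \<partial>M)
    \<le> ennreal (C * s * Gamma (s - \<delta>) * t powr (\<delta> - s))"
proof -
  have "sigma_finite_measure M"
    using growth by (intro sigma_finite_measure_sublevels[OF X]) (auto intro: le_less_trans[OF growth])
  then interpret M: sigma_finite_measure M .
  interpret P: pair_sigma_finite M lborel ..
  \<comment> \<open>Minus the derivative of \<open>y powr (- \<delta>) * exp (- (t * y))\<close>.\<close>
  define g where "g y = (\<delta> * y powr (- \<delta> - 1) + t * y powr (- \<delta>)) * exp (- (t * y))" for y
  have [measurable]: "g \<in> borel_measurable borel"
    unfolding g_def by measurable
  have g0: "g y \<ge> 0" for y using \<delta> t by (simp add: g_def)
  \<comment> \<open>The conjunct \<open>0 < y\<close> stays in the integrand so that, after the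
    exchange of integrals, \<open>y\<close> ranges over the half-line on which the growth bound is
    assumed.\<close>
  have layer: "ennreal (x powr (- \<delta>) * exp (- (t * x)))
      = (\<integral>\<^sup>+y. ennreal (if 0 < y \<and> x \<le> y then g y else 0) \<partial>lborel)" if x: "x > 0" for x
  proof -
    have "(\<integral>\<^sup>+y. ennreal (g y) * indicator {x..} y \<partial>lborel)
        = ennreal (0 - (- (x powr (- \<delta>) * exp (- (t * x)))))"
    proof (rule nn_integral_FTC_atLeast)
      show "((\<lambda>y. - (y powr (- \<delta>) * exp (- (t * y)))) has_real_derivative g y) (at y)" if "x \<le> y" for y
        using that x by (auto intro!: derivative_eq_intros simp: g_def algebra_simps powr_diff)
      have "((\<lambda>y. y powr (- \<delta>)) \<longlongrightarrow> 0) at_top"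
        using \<delta> by (intro tendsto_neg_powr filterlim_ident) auto
      moreover have "((\<lambda>y. exp (- (t * y))) \<longlongrightarrow> 0) at_top"
        using t by (intro filterlim_compose[OF exp_at_bot])
          (auto simp: filterlim_uminus_at_bot intro!: filterlim_tendsto_pos_mult_at_top[OF tendsto_const] filterlim_ident)
      ultimately show "((\<lambda>y. - (y powr (- \<delta>) * exp (- (t * y)))) \<longlongrightarrow> 0) at_top"
        using tendsto_minus[OF tendsto_mult] by fastforce
    qed (use g0 in auto)
    moreover have "(\<integral>\<^sup>+y. ennreal (g y) * indicator {x..} y \<partial>lborel)
        = (\<integral>\<^sup>+y. ennreal (if 0 < y \<and> x \<le> y then g y else 0) \<partial>lborel)"
      using x by (intro nn_integral_cong) (auto simp: indicator_def)
    ultimately show ?thesis by simp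
  qed
  have "(\<integral>\<^sup>+z. ennreal (X z powr (- \<delta>) * exp (- (t * X z))) \<partial>M)
      = (\<integral>\<^sup>+z. \<integral>\<^sup>+y. ennreal (if 0 < y \<and> X z \<le> y then g y else 0) \<partial>lborel \<partial>M)"
    by (intro nn_integral_cong layer pos)
  also have "\<dots> = (\<integral>\<^sup>+y. \<integral>\<^sup>+z. ennreal (if 0 < y \<and> X z \<le> y then g y else 0) \<partial>M \<partial>lborel)"
    by (rule P.Fubini'[symmetric]) measurable
  also have "\<dots> \<le> (\<integral>\<^sup>+y. ennreal (g y * (C * y powr s)) * indicator {0<..} y \<partial>lborel)"
  proof (rule nn_integral_mono)
    fix y :: real
    have "(\<integral>\<^sup>+z. ennreal (if 0 < y \<and> X z \<le> y then g y else 0) \<partial>M)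
        = (\<integral>\<^sup>+z. ennreal (g y) * indicator {0<..} y * indicator {z \<in> space M. X z \<le> y} z \<partial>M)"
      by (intro nn_integral_cong) (auto simp: indicator_def)
    also have "\<dots> = ennreal (g y) * indicator {0<..} y * emeasure M {z \<in> space M. X z \<le> y}"
      by (rule nn_integral_cmult_indicator) measurable
    also have "\<dots> \<le> ennreal (g y * (C * y powr s)) * indicator {0<..} y"
      using growth[of y] C g0[of y]
      by (cases "y > 0") (auto simp: ennreal_mult intro!: mult_left_mono)
    finally show "(\<integral>\<^sup>+z. ennreal (if 0 < y \<and> X z \<le> y then g y else 0) \<partial>M) \<le> \<dots>" .
  qed
  also have "\<dots> = (\<integral>\<^sup>+y. ennreal (g y * (C * y powr s)) \<partial>lebesgue_on {0<..})"
    by (rule nn_integral_lebesgue_on_greaterThan[symmetric])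
  also have "\<dots> = (\<integral>\<^sup>+y. ennreal (C * \<delta>) * ennreal (y powr (s - \<delta> - 1) * exp (- (y * t)))
       + ennreal (C * t) * ennreal (y powr ((s - \<delta> + 1) - 1) * exp (- (y * t))) \<partial>lebesgue_on {0<..})"
  proof (rule nn_integral_cong)
    fix y :: real
    have "g y * (C * y powr s) = C * \<delta> * (y powr (s - \<delta> - 1) * exp (- (y * t)))
        + C * t * (y powr ((s - \<delta> + 1) - 1) * exp (- (y * t)))"
    proof -
      have "y powr (s - \<delta> - 1) = y powr s * y powr (- \<delta> - 1)"
        "y powr ((s - \<delta> + 1) - 1) = y powr s * y powr (- \<delta>)"
        by (simp_all add: algebra_simps flip: powr_add)
      thus ?thesis by (simp add: g_def algebra_simps)
    qed
    thus "ennreal (g y * (C * y powr s)) = ennreal (C * \<delta>) * ennreal (y powr (s - \<delta> - 1) * exp (- (y * t)))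
       + ennreal (C * t) * ennreal (y powr ((s - \<delta> + 1) - 1) * exp (- (y * t)))"
      using C \<delta> t by (simp add: ennreal_mult ennreal_plus)
  qed
  also have "\<dots> = ennreal (C * \<delta>) * ennreal (Gamma (s - \<delta>) * t powr (- (s - \<delta>)))
       + ennreal (C * t) * ennreal (Gamma (s - \<delta> + 1) * t powr (- (s - \<delta> + 1)))"
  proof -
    have [measurable]: "(\<lambda>y. ennreal (y powr a * exp (- (y * t)))) \<in> borel_measurable (lebesgue_on {0<..})" for a
      by measurable
    show ?thesis
      using \<delta> t nn_integral_powr_exp[of "s - \<delta>" t] nn_integral_powr_exp[of "s - \<delta> + 1" t]
      by (simp add: nn_integral_add nn_integral_cmult)
  qed
  also have "\<dots> = ennreal (C * \<delta> * (Gamma (s - \<delta>) * t powr (- (s - \<delta>)))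
       + C * t * (Gamma (s - \<delta> + 1) * t powr (- (s - \<delta> + 1))))"
    using C \<delta> t Gamma_real_pos[of "s - \<delta>"] Gamma_real_pos[of "s - \<delta> + 1"]
    by (simp add: ennreal_mult ennreal_plus less_imp_le)
  \<comment> \<open>The functional equation merges the two terms: their coefficients
    \<open>\<delta>\<close> and \<open>s - \<delta>\<close> add up to \<open>s\<close>.\<close>
  also have "Gamma (s - \<delta> + 1) = (s - \<delta>) * Gamma (s - \<delta>)"
    using \<delta> by (intro Gamma_plus1) (auto elim!: nonpos_Ints_cases)
  also have "t powr (- (s - \<delta> + 1)) = t powr (\<delta> - s) / t"
    using t by (simp add: powr_diff)
  also have "C * \<delta> * (Gamma (s - \<delta>) * t powr (- (s - \<delta>)))
       + C * t * ((s - \<delta>) * Gamma (s - \<delta>) * (t powr (\<delta> - s) / t)) = C * s * Gamma (s - \<delta>) * t powr (\<delta> - s)"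
    using t by (simp add: algebra_simps)
  finally show ?thesis .
qed

text \<open>Hoelder's inequality for the factors \<open>u\<close> and \<open>v\<close> below. The
  \<open>r\<close>-th power of \<open>v\<close> has a Gamma integral with parameter
  \<open>a = 1 - \<kappa> / (p - 1)\<close>, positive because \<open>\<kappa> < p - 1\<close>. The
  exponential is shared between both factors, so decay in \<open>t * x\<close> survives in the bound
  and can later be integrated over \<open>x\<close>.\<close>

lemma Laplace_weighted_Holder:
  fixes g :: "real \<Rightarrow> real"
  assumes p: "1 < p" and \<kappa>: "\<kappa> < p - 1" and x: "x > 0"
    and g [measurable]: "g \<in> borel_measurable (lebesgue_on {0<..})" and g0: "\<And>t. g t \<ge> 0"
    and int: "integrable (lebesgue_on {0<..}) (\<lambda>t. g t powr p * t powr \<kappa> * exp (- (t * x)))"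
  shows "integrable (lebesgue_on {0<..}) (\<lambda>t. g t * exp (- (t * x)))"
    and "(LINT t|lebesgue_on {0<..}. g t * exp (- (t * x))) powr p
      \<le> Gamma (1 - \<kappa> / (p - 1)) powr (p - 1) * x powr (\<kappa> - (p - 1))
         * (LINT t|lebesgue_on {0<..}. g t powr p * t powr \<kappa> * exp (- (t * x)))"
proof -
  let ?L = "lebesgue_on {0<..} :: real measure"
  define r where "r = p / (p - 1)"
  define a where "a = 1 - \<kappa> / (p - 1)"
  have r: "1 < r" "1 / p + 1 / r = 1" and a: "a > 0"
    using p \<kappa> by (auto simp: r_def a_def field_simps)
  define u where "u t = g t * t powr (\<kappa> / p) * exp (- (t * x) / p)" for t
  define v where "v t = t powr (- (\<kappa> / p)) * exp (- (t * x) / r)" for t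
  have [measurable]: "u \<in> borel_measurable ?L" "v \<in> borel_measurable ?L"
    unfolding u_def v_def by measurable
  have expr: "exp y powr c = exp (c * y)" for y c :: real
    by (simp add: powr_def)
  have up: "u t powr p = g t powr p * t powr \<kappa> * exp (- (t * x))" for t
    using p by (simp add: u_def powr_mult powr_powr expr)
  have vr: "v t powr r = t powr (a - 1) * exp (- (t * x))" for t
  proof -
    have "- (\<kappa> / p) * r = a - 1" using p by (simp add: r_def a_def field_simps)
    thus ?thesis using r by (simp add: v_def powr_mult powr_powr expr)
  qed
  have uv: "u t * v t = g t * exp (- (t * x))" if "t \<in> space ?L" for t
  proof -
    have "exp (- (t * x) / p) * exp (- (t * x) / r) = exp (- (t * x) * (1 / p + 1 / r))"
      by (simp add: algebra_simps flip: exp_add)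
    moreover have "t powr (\<kappa> / p) * t powr (- (\<kappa> / p)) = 1"
      using that by (simp add: space_restrict_space flip: powr_add)
    moreover have "u t * v t = g t * (t powr (\<kappa> / p) * t powr (- (\<kappa> / p)))
        * (exp (- (t * x) / p) * exp (- (t * x) / r))"
      by (simp add: u_def v_def mult_ac)
    ultimately show ?thesis using r(2) by simp
  qed
  have Gp: "Gamma a * x powr (- a) \<ge> 0" using a Gamma_real_pos[OF a] by simp
  have V: "has_bochner_integral ?L (\<lambda>t. v t powr r) (Gamma a * x powr (- a))"
    using nn_integral_powr_exp[OF a x] Gp by (intro has_bochner_integral_nn_integral) (auto simp: vr)
  have iu: "integrable ?L (\<lambda>t. u t powr p)" using int by (simp add: up)
  have u0: "u t \<ge> 0" and v0: "v t \<ge> 0" for t by (simp_all add: u_def v_def g0)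
  have iv: "integrable ?L (\<lambda>t. v t powr r)" using V by (simp add: has_bochner_integral_iff)
  note H = Holder_inequality[OF p r _ _ u0 v0 iu iv, simplified]
  show int1: "integrable ?L (\<lambda>t. g t * exp (- (t * x)))"
    using H(1) by (subst Bochner_Integration.integrable_cong[OF refl uv[symmetric]]) auto
  define J where "J = (LINT t|?L. g t powr p * t powr \<kappa> * exp (- (t * x)))"
  have J0: "J \<ge> 0" unfolding J_def by simp
  have "(LINT t|?L. g t * exp (- (t * x))) = (LINT t|?L. u t * v t)"
    by (intro Bochner_Integration.integral_cong refl uv[symmetric])
  also have "\<dots> \<le> J powr (1 / p) * (Gamma a * x powr (- a)) powr (1 / r)"
    using H(2) V by (simp add: up J_def has_bochner_integral_iff)
  finally have "(LINT t|?L. g t * exp (- (t * x))) powr p \<le> (J powr (1 / p) * (Gamma a * x powr (- a)) powr (1 / r)) powr p"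
    using p by (intro powr_mono2) (auto simp: g0)
  also have "\<dots> = J * (Gamma a * x powr (- a)) powr (p - 1)"
    using p J0 by (simp add: powr_mult powr_powr r_def)
  also have "(Gamma a * x powr (- a)) powr (p - 1) = Gamma a powr (p - 1) * x powr (\<kappa> - (p - 1))"
  proof -
    have "- a * (p - 1) = \<kappa> - (p - 1)" using p by (simp add: a_def field_simps)
    thus ?thesis by (simp add: powr_mult powr_powr)
  qed
  finally show "(LINT t|?L. g t * exp (- (t * x))) powr p
      \<le> Gamma (1 - \<kappa> / (p - 1)) powr (p - 1) * x powr (\<kappa> - (p - 1)) * J"
    by (simp add: a_def mult_ac)
qed

subsection \<open>Sufficiency of the Carleson condition\<close>

text \<open>Describing the sector by the slope \<open>Im z / Re z\<close> serves both its
  measurability and the bound on the imaginary part.\<close>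

lemma sector_eq_arctan:
  "sector \<theta> = {z \<in> right_half_plane. \<bar>arctan (Im z / Re z)\<bar> < \<theta>}"
  by (auto simp: sector_def right_half_plane_def arg_conv_arctan)

lemma sector_borel [measurable]: "sector \<theta> \<in> sets borel"
proof -
  have [measurable]: "arctan \<in> borel_measurable borel"
    by (intro borel_measurable_continuous_onI continuous_intros)
  show ?thesis
    unfolding sector_eq_arctan right_half_plane_def by simp
qed

text \<open>Monotonicity of the tangent. On the sector, a bound on \<open>Re z\<close> thus controls
  all of \<open>z\<close>, which the necessity proof exploits.\<close>

lemma sector_abs_Im_le:
  assumes "z \<in> sector \<theta>" "\<theta> < pi / 2"
  shows "\<bar>Im z\<bar> \<le> tan \<theta> * Re z"
proof -
  have z: "Re z > 0" "\<bar>arctan (Im z / Re z)\<bar> < \<theta>"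
    using assms by (auto simp: sector_eq_arctan right_half_plane_def)
  have "arctan \<bar>Im z / Re z\<bar> < \<theta>"
    using z(2) by (simp add: abs_if arctan_minus split: if_splits)
  hence "tan (arctan \<bar>Im z / Re z\<bar>) < tan \<theta>"
    using assms(2) arctan_lbound by (intro tan_monotone) auto
  thus ?thesis using z(1) by (simp add: tan_arctan field_simps)
qed

lemma powr_times_exp_bounded:
  fixes b x :: real
  assumes "b \<ge> 0" "x > 0"
  obtains B where "\<And>t. t > 0 \<Longrightarrow> t powr b * exp (- (t * x)) \<le> B"
proof (cases "b = 0")
  case True
  thus ?thesis using assms by (intro that[of 1]) simp
next
  case False
  show ?thesis
  proof (rule that[of "(b / x) powr b"])
    fix t :: real assume t: "t > 0"
    \<comment> \<open>Raising this to the power \<open>b\<close> gives exactly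
      \<open>exp (t * x)\<close> on the right.\<close>
    have "t * x / b \<le> exp (t * x / b)"
      using exp_ge_add_one_self[of "t * x / b"] by linarith
    hence "(t * x / b) powr b \<le> exp (t * x / b) powr b"
      using assms t by (intro powr_mono2) auto
    also have "\<dots> = exp (t * x)" using False by (simp add: powr_def)
    finally have "(b / x) powr b * (t * x / b) powr b \<le> (b / x) powr b * exp (t * x)"
      by (intro mult_left_mono) auto
    moreover have "(b / x) powr b * (t * x / b) powr b = t powr b"
      using False assms by (simp flip: powr_mult)
    ultimately show "t powr b * exp (- (t * x)) \<le> (b / x) powr b"
      by (simp add: exp_minus field_simps)
  qed
qed

text \<open>The exponential absorbs the surplus factor \<open>t powr (\<kappa> - \<alpha>)\<close>,
  which is bounded near 0 because \<open>\<alpha> \<le> \<kappa>\<close>.\<close>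

lemma integrable_weighted_powr_exp:
  assumes f: "f \<in> weighted_Lp_functions p (\<lambda>t. t powr \<alpha>)" and \<kappa>: "\<alpha> \<le> \<kappa>" and x: "x > 0"
  shows "integrable (lebesgue_on {0<..}) (\<lambda>t. cmod (f t) powr p * t powr \<kappa> * exp (- (t * x)))"
proof -
  let ?L = "lebesgue_on {0<..} :: real measure"
  have [measurable]: "f \<in> borel_measurable ?L"
    and int: "integrable ?L (\<lambda>t. cmod (f t) powr p * t powr \<alpha>)"
    using f by (auto simp: weighted_Lp_functions_def)
  obtain B where B: "\<And>t. t > 0 \<Longrightarrow> t powr (\<kappa> - \<alpha>) * exp (- (t * x)) \<le> B"
    using powr_times_exp_bounded[of "\<kappa> - \<alpha>" x] \<kappa> x by auto
  show ?thesis
  proof (rule Bochner_Integration.integrable_bound)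
    show "integrable ?L (\<lambda>t. B * (cmod (f t) powr p * t powr \<alpha>))"
      using int by simp
    show "AE t in ?L. norm (cmod (f t) powr p * t powr \<kappa> * exp (- (t * x))) \<le> norm (B * (cmod (f t) powr p * t powr \<alpha>))"
    proof (rule AE_I2)
      fix t assume "t \<in> space ?L"
      hence t: "t > 0" by (simp add: space_restrict_space)
      have "cmod (f t) powr p * t powr \<kappa> * exp (- (t * x))
          = (cmod (f t) powr p * t powr \<alpha>) * (t powr (\<kappa> - \<alpha>) * exp (- (t * x)))"
        using t by (simp add: powr_diff)
      also have "\<dots> \<le> (cmod (f t) powr p * t powr \<alpha>) * B"
        using B[OF t] by (intro mult_left_mono) auto
      finally show "norm (cmod (f t) powr p * t powr \<kappa> * exp (- (t * x))) \<le> norm (B * (cmod (f t) powr p * t powr \<alpha>))"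
        by (simp add: mult_ac abs_le_iff)
    qed
  qed measurable
qed

section \<open>Pointwise bounds and measurability of the Laplace transform\<close>

lemma norm_laplace_integrand:
  "norm (laplace_integrand f z t) = cmod (f t) * exp (- (t * Re z))"
  by (simp add: laplace_integrand_def norm_mult)

lemma laplace_integrand_measurable [measurable]:
  assumes [measurable]: "f \<in> borel_measurable (lebesgue_on A)"
  shows "laplace_integrand f z \<in> borel_measurable (lebesgue_on A)"
  unfolding laplace_integrand_def by measurable

text \<open>The weighted Hoelder bound for the modulus of \<open>f\<close>. With
  \<open>\<kappa> = \<alpha>\<close>, its first part is the convergence demanded by
  well-definedness.\<close>

lemma laplace_transform_pointwise:
  assumes p: "1 < p" and f: "f \<in> weighted_Lp_functions p (\<lambda>t. t powr \<alpha>)"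
    and \<kappa>: "\<alpha> \<le> \<kappa>" "\<kappa> < p - 1" and z: "Re z > 0"
  shows "integrable (lebesgue_on {0<..}) (laplace_integrand f z)"
    and "norm (laplace_transform f z) powr p \<le> Gamma (1 - \<kappa> / (p - 1)) powr (p - 1) * Re z powr (\<kappa> - (p - 1))
         * (LINT t|lebesgue_on {0<..}. cmod (f t) powr p * t powr \<kappa> * exp (- (t * Re z)))"
proof -
  let ?L = "lebesgue_on {0<..} :: real measure"
  have f' [measurable]: "f \<in> borel_measurable ?L"
    using f by (auto simp: weighted_Lp_functions_def)
  have m: "(\<lambda>t. cmod (f t)) \<in> borel_measurable ?L" by measurable
  note H = Laplace_weighted_Holder[OF p \<kappa>(2) z m _ integrable_weighted_powr_exp[OF f \<kappa>(1) z]]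
  show int: "integrable ?L (laplace_integrand f z)"
    using H(1) by (intro integrable_norm_cancel[OF _ laplace_integrand_measurable[OF f']])
      (simp add: norm_laplace_integrand)
  have "norm (laplace_transform f z) \<le> (LINT t|?L. cmod (f t) * exp (- (t * Re z)))"
    unfolding laplace_transform_def using integral_norm_bound[of ?L "laplace_integrand f z"]
    by (simp add: norm_laplace_integrand)
  hence "norm (laplace_transform f z) powr p \<le> (LINT t|?L. cmod (f t) * exp (- (t * Re z))) powr p"
    using p by (intro powr_mono2) auto
  also note H(2)
  finally show "norm (laplace_transform f z) powr p \<le> Gamma (1 - \<kappa> / (p - 1)) powr (p - 1) * Re z powr (\<kappa> - (p - 1))
         * (LINT t|?L. cmod (f t) powr p * t powr \<kappa> * exp (- (t * Re z)))" by simp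
qed

text \<open>An integral of a jointly measurable function against a sigma-finite measure depends
  measurably on the parameter.\<close>

lemma laplace_transform_measurable:
  assumes sets: "sets M = sets (restrict_space borel right_half_plane)"
    and f [measurable]: "f \<in> borel_measurable (lebesgue_on {0<..})"
  shows "laplace_transform f \<in> borel_measurable M"
proof -
  interpret L: sigma_finite_measure "lebesgue_on {0<..} :: real measure"
    by (rule sigma_finite_lebesgue_on) simp
  have [measurable]: "(\<lambda>z. z) \<in> borel_measurable M"
    using sets by (subst measurable_cong_sets[OF sets refl]) (intro measurable_restrict_space1, simp)
  show ?thesis
    unfolding laplace_transform_def laplace_integrand_def by measurable
qed

text \<open>Stated for sublevel sets of \<open>Re\<close>, so that the argument depends on
  \<open>Re z\<close> alone; the sector comes in when these sets are compared with the Carleson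
  sets.\<close>

lemma laplace_embedding_estimate:
  fixes M :: "complex measure"
  assumes p: "1 < p" "p \<le> q" and \<alpha>: "\<alpha> < p - 1"
    and sets: "sets M = sets (restrict_space borel right_half_plane)"
    and s: "s = q * (p - 1 - \<alpha>) / p" and C: "C \<ge> 0"
    and growth: "\<And>y. y > 0 \<Longrightarrow> emeasure M {z \<in> space M. Re z \<le> y} \<le> ennreal (C * y powr s)"
  obtains K where "K > 0"
    "\<And>f. f \<in> weighted_Lp_functions p (\<lambda>t. t powr \<alpha>) \<Longrightarrow>
       (\<integral>\<^sup>+z. ennreal (norm (laplace_transform f z) powr q) \<partial>M)
         \<le> ennreal (K * (LINT t|lebesgue_on {0<..}. cmod (f t) powr p * t powr \<alpha>) powr (q / p))"
proof -
  let ?L = "lebesgue_on {0<..} :: real measure"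
  have space: "space M = right_half_plane"
    using sets_eq_imp_space_eq[OF sets] by (simp add: space_restrict_space)
  have id [measurable]: "(\<lambda>z. z) \<in> borel_measurable M"
    using sets by (subst measurable_cong_sets[OF sets refl]) (intro measurable_restrict_space1, simp)
  have Re_meas [measurable]: "Re \<in> borel_measurable M"
    using measurable_compose[OF id borel_measurable_Re] by simp
  have Re_pos: "Re z > 0" if "z \<in> space M" for z
    using that by (simp add: space right_half_plane_def)
  have fin: "emeasure M {z \<in> space M. Re z \<le> y} < \<infinity>" if "y > 0" for y
    using growth[OF that] by (auto intro: le_less_trans)
  interpret L: sigma_finite_measure ?L
    by (rule sigma_finite_lebesgue_on) simp
  interpret M: sigma_finite_measure M
    by (rule sigma_finite_measure_sublevels[OF Re_meas fin])
  interpret P: pair_sigma_finite ?L M ..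
  \<comment> \<open>Any exponent strictly between \<open>\<alpha>\<close> and \<open>p - 1\<close> would do.\<close>
  define \<kappa> where "\<kappa> = (\<alpha> + (p - 1)) / 2"
  have \<kappa>: "\<alpha> < \<kappa>" "\<kappa> < p - 1" using \<alpha> by (auto simp: \<kappa>_def field_simps)
  \<comment> \<open>\<open>- \<delta>\<close> is the total power of \<open>Re z\<close> in the
    product of the two bounds. Since \<open>\<delta> - s = \<alpha> - \<kappa>\<close>, integrating
    over \<open>z\<close> turns the weight \<open>t powr \<kappa>\<close> back into
    \<open>t powr \<alpha>\<close>; \<open>\<alpha> < \<kappa> < p - 1\<close> gives
    \<open>0 < \<delta> < s\<close>.\<close>
  define \<delta> where "\<delta> = (p - 1 - \<kappa>) + (p - 1 - \<alpha>) * ((q - p) / p)"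
  have "s = (p - 1 - \<alpha>) + (p - 1 - \<alpha>) * ((q - p) / p)"
    using p by (simp add: s field_simps)
  hence s\<delta>: "\<delta> - s = \<alpha> - \<kappa>" by (simp add: \<delta>_def)
  have "(p - 1 - \<alpha>) * ((q - p) / p) \<ge> 0" using p \<alpha> by simp
  hence \<delta>: "0 < \<delta>" "\<delta> < s" using \<kappa> s\<delta> by (auto simp: \<delta>_def)
  have s0: "s > 0" using \<delta> by simp
  define c where "c \<kappa> = Gamma (1 - \<kappa> / (p - 1)) powr (p - 1)" for \<kappa>
  have c0: "c k \<ge> 0" for k by (simp add: c_def)
  define D where "D = c \<kappa> * c \<alpha> powr ((q - p) / p)"
  define E where "E = C * s * Gamma (s - \<delta>)"
  have D0: "D \<ge> 0" using c0 by (simp add: D_def)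
  have E0: "E \<ge> 0" using C s0 \<delta> Gamma_real_pos[of "s - \<delta>"] by (simp add: E_def)
  show ?thesis
  \<comment> \<open>Adding 1 makes the constant positive even when \<open>D * E\<close> is 0, as
    happens for \<open>C = 0\<close>.\<close>
  proof (rule that[of "D * E + 1"])
    show "D * E + 1 > 0" using D0 E0 by (smt (verit) mult_nonneg_nonneg)
  next
    fix f assume f: "f \<in> weighted_Lp_functions p (\<lambda>t. t powr \<alpha>)"
    have f' [measurable]: "f \<in> borel_measurable ?L"
      and int: "integrable ?L (\<lambda>t. cmod (f t) powr p * t powr \<alpha>)"
      using f by (auto simp: weighted_Lp_functions_def)
    define N where "N = (LINT t|?L. cmod (f t) powr p * t powr \<alpha>)"
    have N0: "N \<ge> 0" by (simp add: N_def)
    define J where "J x = (LINT t|?L. cmod (f t) powr p * t powr \<kappa> * exp (- (t * x)))" for x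
    have J0: "J x \<ge> 0" for x by (simp add: J_def)
    define R where "R = D * N powr ((q - p) / p)"
    have R0: "R \<ge> 0" using D0 by (simp add: R_def)
    have pointwise: "norm (laplace_transform f z) powr q \<le> R * (Re z powr (- \<delta>) * J (Re z))"
      if z: "Re z > 0" for z
    proof -
      define F where "F = norm (laplace_transform f z)"
      have F1: "F powr p \<le> c \<kappa> * Re z powr (\<kappa> - (p - 1)) * J (Re z)"
        using laplace_transform_pointwise(2)[OF p(1) f _ \<kappa>(2) z] \<kappa> by (simp add: F_def c_def J_def)
      have "F powr p \<le> c \<alpha> * Re z powr (\<alpha> - (p - 1))
          * (LINT t|?L. cmod (f t) powr p * t powr \<alpha> * exp (- (t * Re z)))"
        using laplace_transform_pointwise(2)[OF p(1) f order_refl \<alpha> z] by (simp add: F_def c_def)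
      also have "\<dots> \<le> c \<alpha> * Re z powr (\<alpha> - (p - 1)) * N"
        unfolding N_def
      proof (intro mult_left_mono integral_mono int integrable_weighted_powr_exp[OF f order_refl z])
        fix t assume "t \<in> space ?L"
        thus "cmod (f t) powr p * t powr \<alpha> * exp (- (t * Re z)) \<le> cmod (f t) powr p * t powr \<alpha>"
          using z by (intro mult_left_le) (auto simp: space_restrict_space)
      qed (auto simp: c0)
      finally have F2: "F powr p \<le> c \<alpha> * Re z powr (\<alpha> - (p - 1)) * N" .
      \<comment> \<open>As \<open>p \<le> q\<close>, the exponent \<open>(q - p) / p\<close> is
        nonnegative, so \<open>F2\<close> may be raised to it.\<close>
      have "q = p + p * ((q - p) / p)" using p by simp
      hence "F powr q = F powr p * (F powr p) powr ((q - p) / p)"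
        by (metis powr_add powr_powr)
      also have "\<dots> \<le> (c \<kappa> * Re z powr (\<kappa> - (p - 1)) * J (Re z))
          * (c \<alpha> * Re z powr (\<alpha> - (p - 1)) * N) powr ((q - p) / p)"
        using F1 F2 p c0 J0 by (intro mult_mono powr_mono2) auto
      also have "\<dots> = R * ((Re z powr (\<kappa> - (p - 1)) * Re z powr ((\<alpha> - (p - 1)) * ((q - p) / p))) * J (Re z))"
        by (simp add: R_def D_def powr_mult powr_powr mult_ac)
      also have "Re z powr (\<kappa> - (p - 1)) * Re z powr ((\<alpha> - (p - 1)) * ((q - p) / p)) = Re z powr (- \<delta>)"
      proof -
        have "(\<kappa> - (p - 1)) + (\<alpha> - (p - 1)) * r = - ((p - 1 - \<kappa>) + (p - 1 - \<alpha>) * r)" for r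
          by (simp add: algebra_simps)
        thus ?thesis by (simp add: \<delta>_def flip: powr_add)
      qed
      finally show ?thesis by (simp add: F_def)
    qed
    have J: "ennreal (J x) = (\<integral>\<^sup>+t. ennreal (cmod (f t) powr p * t powr \<kappa> * exp (- (t * x))) \<partial>?L)"
      if "x > 0" for x
      unfolding J_def using that \<kappa>
      by (intro nn_integral_eq_integral[symmetric] integrable_weighted_powr_exp[OF f]) auto
    have "(\<integral>\<^sup>+z. ennreal (norm (laplace_transform f z) powr q) \<partial>M)
        \<le> (\<integral>\<^sup>+z. ennreal R * (\<integral>\<^sup>+t. ennreal (cmod (f t) powr p * t powr \<kappa>) *
               ennreal (Re z powr (- \<delta>) * exp (- (t * Re z))) \<partial>?L) \<partial>M)"
    proof (rule nn_integral_mono)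
      fix z assume "z \<in> space M"
      hence z: "Re z > 0" by (rule Re_pos)
      have "ennreal (norm (laplace_transform f z) powr q) \<le> ennreal (R * (Re z powr (- \<delta>) * J (Re z)))"
        using pointwise[OF z] by (rule ennreal_leI)
      also have "\<dots> = ennreal R * (ennreal (Re z powr (- \<delta>)) * ennreal (J (Re z)))"
        using R0 J0 by (simp add: ennreal_mult)
      also have "ennreal (Re z powr (- \<delta>)) * ennreal (J (Re z))
          = (\<integral>\<^sup>+t. ennreal (Re z powr (- \<delta>)) * ennreal (cmod (f t) powr p * t powr \<kappa> * exp (- (t * Re z))) \<partial>?L)"
        unfolding J[OF z] by (rule nn_integral_cmult[symmetric]) measurable
      also have "\<dots> = (\<integral>\<^sup>+t. ennreal (cmod (f t) powr p * t powr \<kappa>) *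
               ennreal (Re z powr (- \<delta>) * exp (- (t * Re z))) \<partial>?L)"
        by (intro nn_integral_cong) (simp add: mult_ac flip: ennreal_mult)
      finally show "ennreal (norm (laplace_transform f z) powr q) \<le> ennreal R * \<dots>" .
    qed
    also have "\<dots> = ennreal R * (\<integral>\<^sup>+z. \<integral>\<^sup>+t. ennreal (cmod (f t) powr p * t powr \<kappa>) *
               ennreal (Re z powr (- \<delta>) * exp (- (t * Re z))) \<partial>?L \<partial>M)"
      by (rule nn_integral_cmult) measurable
    finally have bound: "(\<integral>\<^sup>+z. ennreal (norm (laplace_transform f z) powr q) \<partial>M) \<le> \<dots>" .
    have "(\<integral>\<^sup>+z. \<integral>\<^sup>+t. ennreal (cmod (f t) powr p * t powr \<kappa>) *
               ennreal (Re z powr (- \<delta>) * exp (- (t * Re z))) \<partial>?L \<partial>M)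
        = (\<integral>\<^sup>+t. \<integral>\<^sup>+z. ennreal (cmod (f t) powr p * t powr \<kappa>) *
               ennreal (Re z powr (- \<delta>) * exp (- (t * Re z))) \<partial>M \<partial>?L)"
      by (rule P.Fubini') measurable
    also have "\<dots> \<le> (\<integral>\<^sup>+t. ennreal E * ennreal (cmod (f t) powr p * t powr \<alpha>) \<partial>?L)"
    proof (rule nn_integral_mono)
      fix t assume "t \<in> space ?L"
      hence t: "t > 0" by (simp add: space_restrict_space)
      have "(\<integral>\<^sup>+z. ennreal (cmod (f t) powr p * t powr \<kappa>) * ennreal (Re z powr (- \<delta>) * exp (- (t * Re z))) \<partial>M)
          = ennreal (cmod (f t) powr p * t powr \<kappa>) * (\<integral>\<^sup>+z. ennreal (Re z powr (- \<delta>) * exp (- (t * Re z))) \<partial>M)"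
        by (rule nn_integral_cmult) measurable
      also have "\<dots> \<le> ennreal (cmod (f t) powr p * t powr \<kappa>) * ennreal (E * t powr (\<delta> - s))"
        unfolding E_def
        by (intro mult_left_mono nn_integral_powr_exp_le[OF Re_meas Re_pos \<delta> C t growth]) auto
      also have "\<dots> = ennreal E * ennreal (cmod (f t) powr p * t powr \<alpha>)"
        using E0 t by (simp add: s\<delta> powr_diff mult_ac flip: ennreal_mult)
      finally show "(\<integral>\<^sup>+z. ennreal (cmod (f t) powr p * t powr \<kappa>) * ennreal (Re z powr (- \<delta>) * exp (- (t * Re z))) \<partial>M) \<le> \<dots>" .
    qed
    also have "\<dots> = ennreal E * ennreal N"
      using int by (subst nn_integral_cmult, measurable) (simp add: nn_integral_eq_integral N_def)
    finally have "(\<integral>\<^sup>+z. ennreal (norm (laplace_transform f z) powr q) \<partial>M) \<le> ennreal R * (ennreal E * ennreal N)"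
      using bound by (blast intro: order_trans mult_left_mono zero_le)
    \<comment> \<open>One power of \<open>N\<close> comes from the double integral, the remaining
      \<open>(q - p) / p\<close> from \<open>R\<close>; together they make
      \<open>q / p\<close>.\<close>
    also have "ennreal R * (ennreal E * ennreal N) = ennreal (D * E * (N * N powr ((q - p) / p)))"
      using R0 E0 N0 by (simp add: R_def mult_ac flip: ennreal_mult)
    also have "N * N powr ((q - p) / p) = N powr (1 + (q - p) / p)"
      using N0 by (rule powr_mult_base)
    also have "1 + (q - p) / p = q / p" using p by (simp add: field_simps)
    also have "ennreal (D * E * N powr (q / p)) \<le> ennreal ((D * E + 1) * N powr (q / p))"
      by (intro ennreal_leI mult_right_mono) auto
    finally show "(\<integral>\<^sup>+z. ennreal (norm (laplace_transform f z) powr q) \<partial>M)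
         \<le> ennreal ((D * E + 1) * (LINT t|?L. cmod (f t) powr p * t powr \<alpha>) powr (q / p))"
      by (simp add: N_def)
  qed
qed

text \<open>The two sets differ only inside \<open>right_half_plane - sector \<theta>\<close>, which
  is null.\<close>

lemma emeasure_Re_sublevel_eq_carleson_set:
  fixes M :: "complex measure"
  assumes sets: "sets M = sets (restrict_space borel right_half_plane)"
    and null: "emeasure M (right_half_plane - sector \<theta>) = 0"
  shows "emeasure M {z \<in> space M. Re z \<le> y} = emeasure M (carleson_set \<theta> y)"
proof (rule emeasure_eq_AE)
  have space: "space M = right_half_plane"
    using sets_eq_imp_space_eq[OF sets] by (simp add: space_restrict_space)
  have rhp [measurable]: "right_half_plane \<in> sets borel"
    unfolding right_half_plane_def by simp
  have "right_half_plane - sector \<theta> \<in> sets M"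
    unfolding sets using rhp by (subst sets_restrict_space_iff) auto
  hence "AE z in M. z \<notin> right_half_plane - sector \<theta>"
    using null by (intro AE_not_in null_setsI)
  thus "AE z in M. z \<in> {z \<in> space M. Re z \<le> y} \<longleftrightarrow> z \<in> carleson_set \<theta> y"
    by eventually_elim (auto simp: space carleson_set_def sector_def)
  have "{z. Re z \<le> y} \<in> sets borel" by simp
  moreover have "{z \<in> space M. Re z \<le> y} = {z. Re z \<le> y} \<inter> right_half_plane"
    by (auto simp: space)
  moreover have "carleson_set \<theta> y = ({z. Re z \<le> y} \<inter> sector \<theta>)" "sector \<theta> \<subseteq> right_half_plane"
    by (auto simp: carleson_set_def sector_def)
  ultimately show "{z \<in> space M. Re z \<le> y} \<in> sets M" "carleson_set \<theta> y \<in> sets M"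
    unfolding sets using rhp by (auto simp: sets_restrict_space_iff)
qed

lemma carleson_condition_sufficient:
  fixes M :: "complex measure"
  assumes p: "1 < p" "p \<le> q" and \<alpha>: "\<alpha> < p - 1"
    and sets: "sets M = sets (restrict_space borel right_half_plane)"
    and null: "emeasure M (right_half_plane - sector \<theta>) = 0"
    and s: "s = q * (p - 1 - \<alpha>) / p"
    and C: "C > 0" "\<And>l. l > 0 \<Longrightarrow> emeasure M (carleson_set \<theta> l) \<le> ennreal (C * l powr s)"
  shows "laplace_embedding_well_defined p (\<lambda>t. t powr \<alpha>) q M"
    and "laplace_embedding_bounded p (\<lambda>t. t powr \<alpha>) q M"
proof -
  let ?W = "weighted_Lp_functions p (\<lambda>t. t powr \<alpha>)"
  define N where "N f = (LINT t|lebesgue_on {0<..}. cmod (f t) powr p * t powr \<alpha>)" for f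
  obtain K where K: "K > 0" and est: "\<And>f. f \<in> ?W \<Longrightarrow>
       (\<integral>\<^sup>+z. ennreal (norm (laplace_transform f z) powr q) \<partial>M) \<le> ennreal (K * N f powr (q / p))"
    unfolding N_def
    using laplace_embedding_estimate[OF p \<alpha> sets s less_imp_le[OF C(1)]] C(2)
    unfolding emeasure_Re_sublevel_eq_carleson_set[OF sets null] by blast
  have meas: "laplace_transform f \<in> borel_measurable M" if "f \<in> ?W" for f
    using that by (intro laplace_transform_measurable[OF sets]) (simp add: weighted_Lp_functions_def)
  have int: "integrable M (\<lambda>z. norm (laplace_transform f z) powr q)" if f: "f \<in> ?W" for f
    using meas[OF f] le_less_trans[OF est[OF f] ennreal_less_top] by (intro integrableI_nonneg) auto
  show "laplace_embedding_well_defined p (\<lambda>t. t powr \<alpha>) q M"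
    unfolding laplace_embedding_well_defined_def Lp_functions_def
    using laplace_transform_pointwise(1)[OF p(1) _ order_refl \<alpha>] meas int
    by (auto simp: right_half_plane_def)
  show "laplace_embedding_bounded p (\<lambda>t. t powr \<alpha>) q M"
    unfolding laplace_embedding_bounded_def
  \<comment> \<open>Raising the estimate to the power \<open>p / q\<close> turns
    \<open>N f powr (q / p)\<close> into \<open>N f\<close> and \<open>K\<close> into this
    constant.\<close>
  proof (intro exI[of _ "K powr (p / q)"] conjI ballI)
    fix f assume f: "f \<in> ?W"
    have "ennreal (LINT z|M. norm (laplace_transform f z) powr q) \<le> ennreal (K * N f powr (q / p))"
      using est[OF f] int[OF f] by (subst nn_integral_eq_integral[symmetric]) auto
    hence "(LINT z|M. norm (laplace_transform f z) powr q) \<le> K * N f powr (q / p)"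
      using K by (subst (asm) ennreal_le_iff) auto
    hence "(LINT z|M. norm (laplace_transform f z) powr q) powr (p / q) \<le> (K * N f powr (q / p)) powr (p / q)"
      using p by (intro powr_mono2) auto
    also have "\<dots> = K powr (p / q) * N f"
      using p by (simp add: powr_mult powr_powr N_def)
    finally show "(LINT z|M. norm (laplace_transform f z) powr q) powr (p / q)
        \<le> K powr (p / q) * (LINT t|lebesgue_on {0<..}. cmod (f t) powr p * t powr \<alpha>)"
      by (simp add: N_def)
  qed (use K in simp)
qed

subsection \<open>Necessity of the Carleson condition\<close>

lemma has_bochner_integral_indicator_lebesgue_on:
  fixes a b :: real
  assumes "0 < a" "a \<le> b"
  shows "has_bochner_integral (lebesgue_on {0<..}) (indicat_real {a..b}) (b - a)"
proof -
  have sub: "{a..b} \<subseteq> {0<..}" using assms by auto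
  have "{a..b} \<in> sets (lebesgue_on {0<..})" "emeasure (lebesgue_on {0<..}) {a..b} = ennreal (b - a)"
    using assms sub by (auto simp: sets_restrict_space_iff emeasure_restrict_space)
  thus ?thesis
    using has_bochner_integral_real_indicator[of "{a..b}" "lebesgue_on {0<..}"] assms
    by (simp add: measure_def)
qed

text \<open>The maximum is at \<open>b\<close> for \<open>\<alpha> \<ge> 0\<close> and at
  \<open>b / 2\<close> otherwise; the sum \<open>1 + 2 powr (- \<alpha>)\<close> serves both
  cases.\<close>

lemma powr_le_on_dyadic_interval:
  fixes t b \<alpha> :: real
  assumes "b > 0" "b / 2 \<le> t" "t \<le> b"
  shows "t powr \<alpha> \<le> (1 + 2 powr (- \<alpha>)) * b powr \<alpha>"
proof (cases "\<alpha> \<ge> 0")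
  case True
  hence "t powr \<alpha> \<le> b powr \<alpha>" using assms by (intro powr_mono2) auto
  also have "\<dots> \<le> (1 + 2 powr (- \<alpha>)) * b powr \<alpha>" by (simp add: algebra_simps)
  finally show ?thesis .
next
  case False
  hence "t powr \<alpha> \<le> (b / 2) powr \<alpha>" using assms by (intro powr_mono2') auto
  also have "\<dots> = 2 powr (- \<alpha>) * b powr \<alpha>" by (simp add: powr_divide powr_minus field_simps)
  also have "\<dots> \<le> (1 + 2 powr (- \<alpha>)) * b powr \<alpha>" by (simp add: algebra_simps)
  finally show ?thesis .
qed

text \<open>The interval keeps away from 0, so the weight is integrable on it even for
  \<open>\<alpha> \<le> -1\<close>.\<close>

lemma weighted_Lp_indicator:
  fixes b p \<alpha> :: real
  assumes b: "b > 0"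
  defines "f \<equiv> indicator {b / 2..b} :: real \<Rightarrow> complex"
  shows "f \<in> weighted_Lp_functions p (\<lambda>t. t powr \<alpha>)"
    and "(LINT t|lebesgue_on {0<..}. norm (f t) powr p * t powr \<alpha>)
      \<le> (1 + 2 powr (- \<alpha>)) * b powr (\<alpha> + 1) / 2"
proof -
  let ?L = "lebesgue_on {0<..} :: real measure"
  define W where "W = (1 + 2 powr (- \<alpha>)) * b powr \<alpha>"
  have I: "has_bochner_integral ?L (\<lambda>t. W * indicator {b / 2..b} t) (W * (b - b / 2))"
    using b by (intro has_bochner_integral_mult_right has_bochner_integral_indicator_lebesgue_on) auto
  have [measurable]: "{b / 2..b} \<in> sets ?L"
    using b by (auto simp: sets_restrict_space_iff)
  have le: "norm (f t) powr p * t powr \<alpha> \<le> W * indicator {b / 2..b} t" for t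
    using powr_le_on_dyadic_interval[OF b, of t \<alpha>] by (auto simp: f_def W_def indicator_def)
  have fm [measurable]: "f \<in> borel_measurable ?L" unfolding f_def by measurable
  have int: "integrable ?L (\<lambda>t. norm (f t) powr p * t powr \<alpha>)"
    by (rule Bochner_Integration.integrable_bound[OF integrable.intros[OF I]])
      (use le in \<open>auto intro!: AE_I2 order_trans[OF _ abs_ge_self]\<close>)
  thus "f \<in> weighted_Lp_functions p (\<lambda>t. t powr \<alpha>)"
    by (simp add: weighted_Lp_functions_def fm)
  have "(LINT t|?L. norm (f t) powr p * t powr \<alpha>) \<le> (LINT t|?L. W * indicator {b / 2..b} t)"
    using int I le by (intro integral_mono) (auto simp: has_bochner_integral_iff)
  also have "\<dots> = W * (b - b / 2)" using I by (simp add: has_bochner_integral_iff)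
  also have "\<dots> = (1 + 2 powr (- \<alpha>)) * b powr (\<alpha> + 1) / 2"
    using b by (simp add: W_def powr_add field_simps)
  finally show "(LINT t|?L. norm (f t) powr p * t powr \<alpha>) \<le> \<dots>" .
qed

text \<open>On the support of \<open>f\<close>, \<open>t * Re z \<le> 1\<close> and
  \<open>t * Im z\<close> lies in \<open>[-1, 1]\<close>, so there is no cancellation: the real part
  of the kernel is at least \<open>exp (- 1) * cos 1 > 0\<close> on an interval of length
  \<open>b / 2\<close>.\<close>

lemma laplace_transform_indicator_ge:
  fixes b :: real
  assumes b: "b > 0" and z: "b * Re z \<le> 1" "b * \<bar>Im z\<bar> \<le> 1"
  defines "f \<equiv> indicator {b / 2..b} :: real \<Rightarrow> complex"
  assumes int: "integrable (lebesgue_on {0<..}) (laplace_integrand f z)"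
  shows "exp (- 1) * cos 1 / 2 * b \<le> norm (laplace_transform f z)"
proof -
  let ?L = "lebesgue_on {0<..} :: real measure"
  have I: "has_bochner_integral ?L (\<lambda>t. exp (- 1) * cos 1 * indicator {b / 2..b} t) (exp (- 1) * cos 1 * (b - b / 2))"
    using b by (intro has_bochner_integral_mult_right has_bochner_integral_indicator_lebesgue_on) auto
  have cos1: "cos (1 :: real) > 0" using pi_gt3 by (intro cos_gt_zero) auto
  have "exp (- 1) * cos 1 / 2 * b = (LINT t|?L. exp (- 1) * cos 1 * indicator {b / 2..b} t)"
    unfolding has_bochner_integral_integral_eq[OF I] by simp
  also have "\<dots> \<le> (LINT t|?L. Re (laplace_integrand f z t))"
  proof (intro integral_mono integrable_Re int integrable.intros[OF I])
    fix t
    show "exp (- 1) * cos 1 * indicator {b / 2..b} t \<le> Re (laplace_integrand f z t)"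
    proof (cases "t \<in> {b / 2..b}")
      case True
      have "t * Re z \<le> 1"
        using True b z(1) by (cases "Re z \<ge> 0") (auto intro: order_trans[OF mult_right_mono] order_trans[OF mult_nonneg_nonpos])
      moreover have "\<bar>t * Im z\<bar> \<le> 1"
        using True b z(2) mult_right_mono[of t b "\<bar>Im z\<bar>"] by (simp add: abs_mult)
      hence "cos 1 \<le> cos \<bar>t * Im z\<bar>"
        using pi_gt3 by (intro cos_monotone_0_pi_le) auto
      hence "cos 1 \<le> cos (t * Im z)" by simp
      ultimately have "exp (- 1) * cos 1 \<le> exp (- (t * Re z)) * cos (t * Im z)"
        using cos1 by (intro mult_mono) auto
      thus ?thesis using True by (simp add: f_def laplace_integrand_def Re_exp)
    qed (simp add: f_def laplace_integrand_def)
  qed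
  also have "\<dots> = Re (laplace_transform f z)"
    unfolding laplace_transform_def by (rule integral_Re[OF int])
  also have "\<dots> \<le> norm (laplace_transform f z)" by (rule complex_Re_le_cmod)
  finally show ?thesis .
qed

lemma carleson_condition_necessary:
  fixes M :: "complex measure"
  assumes p: "1 < p" "p \<le> q" and \<theta>: "0 \<le> \<theta>" "\<theta> < pi / 2"
    and sets: "sets M = sets (restrict_space borel right_half_plane)"
    and wd: "laplace_embedding_well_defined p (\<lambda>t. t powr \<alpha>) q M"
    and bd: "laplace_embedding_bounded p (\<lambda>t. t powr \<alpha>) q M"
    and s: "s = q * (p - 1 - \<alpha>) / p"
  shows "\<exists>C>0. \<forall>l>0. emeasure M (carleson_set \<theta> l) \<le> ennreal (C * l powr s)"
proof -
  have space: "space M = right_half_plane"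
    using sets_eq_imp_space_eq[OF sets] by (simp add: space_restrict_space)
  obtain C where C: "C > 0" and bound: "\<And>f. f \<in> weighted_Lp_functions p (\<lambda>t. t powr \<alpha>) \<Longrightarrow>
      (LINT z|M. norm (laplace_transform f z) powr q) powr (p / q)
         \<le> C * (LINT t|lebesgue_on {0<..}. norm (f t) powr p * t powr \<alpha>)"
    using bd unfolding laplace_embedding_bounded_def by blast
  define W :: real where "W = 1 + 2 powr (- \<alpha>)"
  define k :: real where "k = exp (- 1) * cos 1 / 2"
  \<comment> \<open>Chosen to satisfy both \<open>c \<le> 1\<close> and
    \<open>c * tan \<theta> \<le> 1\<close>; with \<open>b = c / l\<close> these bound
    \<open>b * Re z\<close> and \<open>b * \<bar>Im z\<bar>\<close> by 1 on the Carleson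
    set.\<close>
  define c where "c = 1 / (1 + tan \<theta>)"
  have T: "tan \<theta> \<ge> 0" using \<theta> tan_gt_zero[of \<theta>] by (cases "\<theta> = 0") auto
  have k: "k > 0" using pi_gt3 unfolding k_def by (intro divide_pos_pos mult_pos_pos cos_gt_zero) auto
  have W: "W > 0" by (simp add: W_def add_pos_pos)
  have c: "c > 0" "c \<le> 1" "c * tan \<theta> \<le> 1" using T by (auto simp: c_def field_simps)
  \<comment> \<open>The factors come, in order, from Markov's inequality at level
    \<open>(k * b) powr q\<close>, from the embedding bound for \<open>f\<close>, and from rewriting
    \<open>b powr (- s)\<close> in terms of \<open>l\<close>.\<close>
  define C' where "C' = k powr (- q) * (C * W / 2) powr (q / p) * c powr (- s)"
  have "emeasure M (carleson_set \<theta> l) \<le> ennreal (C' * l powr s)" if l: "l > 0" for l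
  proof -
    define b where "b = c / l"
    have b: "b > 0" using c l by (simp add: b_def)
    define f where "f = (indicator {b / 2..b} :: real \<Rightarrow> complex)"
    have f: "f \<in> weighted_Lp_functions p (\<lambda>t. t powr \<alpha>)"
      and N: "(LINT t|lebesgue_on {0<..}. norm (f t) powr p * t powr \<alpha>) \<le> W * b powr (\<alpha> + 1) / 2"
      unfolding f_def W_def by (rule weighted_Lp_indicator[OF b])+
    have int: "integrable (lebesgue_on {0<..}) (laplace_integrand f z)" if "z \<in> right_half_plane" for z
      using wd f that by (auto simp: laplace_embedding_well_defined_def)
    have Lq: "integrable M (\<lambda>z. norm (laplace_transform f z) powr q)"
      using wd f by (auto simp: laplace_embedding_well_defined_def Lp_functions_def)
    define I where "I = (LINT z|M. norm (laplace_transform f z) powr q)"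
    have I0: "I \<ge> 0" by (simp add: I_def)
    have "I powr (p / q) \<le> C * (W * b powr (\<alpha> + 1) / 2)"
      unfolding I_def by (rule order_trans[OF bound[OF f] mult_left_mono[OF N]]) (use C in simp)
    hence "(I powr (p / q)) powr (q / p) \<le> (C * (W * b powr (\<alpha> + 1) / 2)) powr (q / p)"
      using p by (intro powr_mono2) auto
    hence "I \<le> (C * (W * b powr (\<alpha> + 1) / 2)) powr (q / p)"
      using p I0 by (simp add: powr_powr)
    also have "\<dots> = ((C * W / 2) * b powr (\<alpha> + 1)) powr (q / p)" by (simp add: mult.assoc)
    also have "\<dots> = (C * W / 2) powr (q / p) * b powr ((\<alpha> + 1) * (q / p))"
      unfolding powr_mult powr_powr ..
    finally have I: "I \<le> (C * W / 2) powr (q / p) * b powr ((\<alpha> + 1) * (q / p))" .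
    have sub: "carleson_set \<theta> l \<subseteq> {z \<in> space M. (k * b) powr q \<le> norm (laplace_transform f z) powr q}"
    proof
      fix z assume z: "z \<in> carleson_set \<theta> l"
      hence zr: "z \<in> right_half_plane" "Re z > 0" "Re z \<le> l" "z \<in> sector \<theta>"
        by (auto simp: carleson_set_def sector_def right_half_plane_def)
      have bz: "b * Re z \<le> c" using zr l c by (simp add: b_def field_simps)
      have "b * \<bar>Im z\<bar> \<le> b * (tan \<theta> * Re z)"
        using b sector_abs_Im_le[OF zr(4) \<theta>(2)] by (intro mult_left_mono) auto
      also have "\<dots> = tan \<theta> * (b * Re z)" by simp
      also have "\<dots> \<le> tan \<theta> * c" using T bz by (intro mult_left_mono)
      finally have "b * \<bar>Im z\<bar> \<le> 1" using c by (simp add: mult.commute)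
      hence "k * b \<le> norm (laplace_transform f z)"
        unfolding k_def f_def using bz c int[OF zr(1)]
        by (intro laplace_transform_indicator_ge b) (auto simp: f_def)
      thus "z \<in> {z \<in> space M. (k * b) powr q \<le> norm (laplace_transform f z) powr q}"
        using zr k b p by (auto simp: space intro!: powr_mono2)
    qed
    have "emeasure M (carleson_set \<theta> l) \<le> emeasure M {z \<in> space M. (k * b) powr q \<le> norm (laplace_transform f z) powr q}"
      by (intro emeasure_mono[OF sub] borel_measurable_le borel_measurable_const borel_measurable_integrable[OF Lq])
    also have "\<dots> \<le> ennreal (1 / ((k * b) powr q) * I)"
      unfolding I_def using k b by (intro integral_Markov_inequality Lq) auto
    finally have Markov: "emeasure M (carleson_set \<theta> l) \<le> ennreal (1 / ((k * b) powr q) * I)" .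
    have "1 / ((k * b) powr q) * I
        \<le> 1 / ((k * b) powr q) * ((C * W / 2) powr (q / p) * b powr ((\<alpha> + 1) * (q / p)))"
      using I by (intro mult_left_mono) auto
    also have "\<dots> = k powr (- q) * (C * W / 2) powr (q / p) * (b powr (- q) * b powr ((\<alpha> + 1) * (q / p)))"
    proof -
      have "1 / ((k * b) powr q) = k powr (- q) * b powr (- q)"
        by (simp add: powr_mult powr_minus field_simps)
      thus ?thesis by (simp only: mult_ac)
    qed
    also have "b powr (- q) * b powr ((\<alpha> + 1) * (q / p)) = b powr (- s)"
    proof -
      have "- q + (\<alpha> + 1) * (q / p) = - s" using p by (simp add: s field_simps)
      thus ?thesis by (simp flip: powr_add)
    qed
    also have "b powr (- s) = c powr (- s) * l powr s"
      by (simp add: b_def powr_divide powr_minus field_simps)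
    finally have "1 / ((k * b) powr q) * I \<le> C' * l powr s" by (simp only: C'_def mult_ac)
    thus ?thesis by (rule order_trans[OF Markov ennreal_leI])
  qed
  moreover have "C' > 0" using k C W c by (simp add: C'_def)
  ultimately show ?thesis by blast
qed

theorem theorem6:
  fixes p q p' \<theta> \<alpha> :: real and \<mu> :: "complex measure"
  assumes "1 < p" and "p \<le> q"
    and "p' = p / (p - 1)"
    and "0 \<le> \<theta>" and "\<theta> < pi / 2"
    and "\<alpha> < p - 1"
    and "sets \<mu> = sets (restrict_space borel right_half_plane)"
    and "emeasure \<mu> (right_half_plane - sector \<theta>) = 0"
  shows "laplace_embedding_well_defined p (\<lambda>t. t powr \<alpha>) q \<mu> \<and>
         laplace_embedding_bounded p (\<lambda>t. t powr \<alpha>) q \<mu>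
     \<longleftrightarrow>
         (\<exists>C>0. \<forall>l>0. emeasure \<mu> (carleson_set \<theta> l)
            \<le> ennreal (C * l powr (q / p' * (1 - \<alpha> / (p - 1)))))"
proof -
  \<comment> \<open>Both directions are proved with the exponent free of \<open>p'\<close>; here
    \<open>1 / p' = (p - 1) / p\<close> cancels the denominator \<open>p - 1\<close>.\<close>
  have s: "q / p' * (1 - \<alpha> / (p - 1)) = q * (p - 1 - \<alpha>) / p"
    using assms(1) by (simp add: assms(3) field_simps)
  show ?thesis
    using carleson_condition_necessary[OF assms(1,2,4,5,7) _ _ s]
      carleson_condition_sufficient[OF assms(1,2,6,7,8) s]
    by blast
qed

end
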